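(* For any integer $p\geq 1$, any randomized $p$-pass insertion-only streaming algorithm that, given an integer $1\leq k\leq n/2$ before the stream and an $n$-vertex (multi-)graph $G=(V,E)$ in the stream, outputs whether $G$ is $k$-vertex-connected with probability at least $2/3$, needs $\Omega(kn/p)$ bits of space.
   Context: In an insertion-only stream the edges of $G$ arrive one by one in arbitrary order (no deletions); a $p$-pass algorithm reads the stream $p$ times in the same order, and its space is the number of bits of memory it maintains. The vertex connectivity of an undirected graph is the minimum number of vertices whose removal disconnects it or leaves a single vertex; $G$ is $k$-vertex-connected if this is at least $k$. *)

theory Defs
  imports "HOL-Probability.Probability_Mass_Function" "HOL-Library.Multiset"
begin

section \<open>Vertex connectivity of undirected multigraphs\<close>

text \<open>
  An edge is the set of its two endpoints. Parallel edges are recorded by the multiplicity in the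
  multiset of edges; loops are excluded.
\<close>

definition multigraph :: "'a set \<Rightarrow> 'a set multiset \<Rightarrow> bool" where
  "multigraph V E \<longleftrightarrow> finite V \<and> (\<forall>e \<in># E. e \<subseteq> V \<and> card e = 2)"

text \<open>
  Edges with an endpoint outside \<open>V\<close> are ignored here, so \<open>connected_graph (V - S) E\<close> speaks about
  the graph that remains when the vertices in \<open>S\<close> are removed.
\<close>

definition connected_graph :: "'a set \<Rightarrow> 'a set multiset \<Rightarrow> bool" where
  "connected_graph V E \<longleftrightarrow>
     (\<forall>u \<in> V. \<forall>v \<in> V. (u, v) \<in> {(x, y). x \<in> V \<and> y \<in> V \<and> {x, y} \<in># E}\<^sup>*)"

definition vertex_connectivity :: "'a set \<Rightarrow> 'a set multiset \<Rightarrow> nat" where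
  "vertex_connectivity V E =
     (LEAST c. \<exists>S \<subseteq> V. card S = c \<and> (\<not> connected_graph (V - S) E \<or> card (V - S) = 1))"

definition vertex_connected :: "nat \<Rightarrow> 'a set \<Rightarrow> 'a set multiset \<Rightarrow> bool" where
  "vertex_connected k V E \<longleftrightarrow> k \<le> vertex_connectivity V E"

section \<open>Randomized multi-pass streaming algorithms\<close>

text \<open>
  No computational restriction is imposed, and only the memory content (a bit string) is charged
  for. The algorithm has two free sources of randomness: a tape, drawn once at the beginning and
  readable (but not writable) at all times, and fresh coins, which is why every component returns
  a distribution. The index of the current pass is also available for free, and the end of a pass
  is announced.

    \<^item> \<open>tape\<close>: the distribution of the tape content (encoded as a natural number);
    \<^item> \<open>start r\<close>: the initial memory content for tape content \<open>r\<close>;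
    \<^item> \<open>step r i m e\<close>: the new memory content when the edge \<open>e\<close> arrives in pass \<open>i\<close>
      (counted from \<open>0\<close>) and the memory content is \<open>m\<close>;
    \<^item> \<open>pass_end r i m\<close>: the new memory content at the end of pass \<open>i\<close>;
    \<^item> \<open>verdict r m\<close>: the output for final memory content \<open>m\<close>.
\<close>

record stream_alg =
  tape :: "nat pmf"
  start :: "nat \<Rightarrow> bool list pmf"
  step :: "nat \<Rightarrow> nat \<Rightarrow> bool list \<Rightarrow> nat set \<Rightarrow> bool list pmf"
  pass_end :: "nat \<Rightarrow> nat \<Rightarrow> bool list \<Rightarrow> bool list pmf"
  verdict :: "nat \<Rightarrow> bool list \<Rightarrow> bool pmf"

primrec read_edges ::
  "(bool list \<Rightarrow> nat set \<Rightarrow> bool list pmf) \<Rightarrow> nat set list \<Rightarrow> bool list \<Rightarrow> bool list pmf" where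
  "read_edges f [] m = return_pmf m"
| "read_edges f (e # es) m = bind_pmf (f m e) (read_edges f es)"

primrec after_passes :: "stream_alg \<Rightarrow> nat \<Rightarrow> nat set list \<Rightarrow> nat \<Rightarrow> bool list pmf" where
  "after_passes A r es 0 = start A r"
| "after_passes A r es (Suc i) =
     bind_pmf (bind_pmf (after_passes A r es i) (read_edges (step A r i) es)) (pass_end A r i)"

definition answer :: "stream_alg \<Rightarrow> nat \<Rightarrow> nat set list \<Rightarrow> bool pmf" where
  "answer A p es = bind_pmf (tape A) (\<lambda>r. bind_pmf (after_passes A r es p) (verdict A r))"

text \<open>
  All memory contents that occur with positive probability at some point of a \<open>p\<close>-pass run on the
  stream \<open>es\<close>: at the very end, or in pass \<open>i\<close> after the first \<open>t\<close> edges have been read.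
\<close>

definition memory_contents :: "stream_alg \<Rightarrow> nat \<Rightarrow> nat set list \<Rightarrow> bool list set" where
  "memory_contents A p es = (\<Union>r \<in> set_pmf (tape A).
     set_pmf (after_passes A r es p) \<union>
     (\<Union>i<p. \<Union>t\<le>length es.
        set_pmf (bind_pmf (after_passes A r es i) (read_edges (step A r i) (take t es)))))"

text \<open>
  An \<open>n\<close>-vertex graph has vertex set \<open>{..<n}\<close>. An insertion-only stream of a graph lists its edges,
  with multiplicity, in arbitrary order.
\<close>

definition stream_of :: "nat \<Rightarrow> nat set multiset \<Rightarrow> nat set list \<Rightarrow> bool" where
  "stream_of n E es \<longleftrightarrow> multigraph {..<n} E \<and> mset es = E"

definition uses_space :: "stream_alg \<Rightarrow> nat \<Rightarrow> nat \<Rightarrow> nat \<Rightarrow> bool" where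
  "uses_space A p n s \<longleftrightarrow>
     (\<forall>E es. stream_of n E es \<longrightarrow> (\<forall>m \<in> memory_contents A p es. length m \<le> s))"

definition decides_vertex_connected :: "stream_alg \<Rightarrow> nat \<Rightarrow> nat \<Rightarrow> nat \<Rightarrow> bool" where
  "decides_vertex_connected A p n k \<longleftrightarrow>
     (\<forall>E es. stream_of n E es \<longrightarrow> pmf (answer A p es) (vertex_connected k {..<n} E) \<ge> 2 / 3)"

end

theory Submission
  imports Defs
begin

text \<open>
  The graph \<open>K\<^bsub>k,n-k\<^esub>\<close> is \<open>k\<close>-connected and every vertex on the larger side has degree \<open>k\<close>, so
  deleting any edge destroys \<open>k\<close>-connectivity. If Alice streams the edges outside \<open>x\<close> and Bob those
  outside \<open>y\<close>, then exactly the edges in \<open>x \<inter> y\<close> are missing, and a \<open>p\<close>-pass algorithm with \<open>s\<close> bits is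
  an \<open>O(p s)\<close>-bit protocol for set disjointness on \<open>k (n - k) \<ge> k n / 2\<close> points.

  The linear lower bound for disjointness follows the information complexity argument of Bar-Yossef,
  Jayram, Kumar and Sivakumar. A random \<open>d\<close> decides who receives each coordinate of a uniformly
  random \<open>z\<close>; the other player receives \<open>0\<close> there. The level-one inequality, applied to the posterior
  of \<open>z\<close> given the transcript, bounds the sum over all coordinates \<open>i\<close> of the squared Hellinger
  distance between the transcript distributions for \<open>i \<notin> z\<close> and \<open>i \<in> z\<close> by the logarithm of the
  number of transcripts; this takes the place of the chain rule for mutual information. Since a
  transcript has a probability of the form \<open>a x * b y\<close>, the inputs \<open>(0,0)\<close> and \<open>(1,1)\<close> at \<open>i\<close> are as
  far apart as \<open>(0,1)\<close> and \<open>(1,0)\<close>, both of which are close to \<open>(0,0)\<close> for an average \<open>i\<close>; yet the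
  answer separates them.
\<close>

section \<open>Set disjointness\<close>

lemma exp_plus_exp_minus_le:
  fixes x :: real
  assumes "\<bar>x\<bar> \<le> 1"
  shows "exp (- x) + exp x \<le> 2 * exp (x\<^sup>2)"
proof -
  have *: "exp (- y) + exp y \<le> 2 * exp (y\<^sup>2)" if "0 \<le> y" "y \<le> 1" for y :: real
  proof -
    \<comment> \<open>The product is \<open>1 + y^3\<close>. The resulting bound on
      \<open>exp (- y)\<close> has the linear term that cancels the one in the bound on
      \<open>exp y\<close>.\<close>
    have "1 \<le> (1 - y + y\<^sup>2) * (1 + y)"
      using that by (simp add: algebra_simps power2_eq_square)
    also have "\<dots> \<le> (1 - y + y\<^sup>2) * exp y"
      using that by (intro mult_left_mono) (auto simp: exp_ge_add_one_self)
    finally have "exp (- y) \<le> 1 - y + y\<^sup>2"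
      by (simp add: exp_minus field_simps)
    moreover have "exp y \<le> 1 + y + y\<^sup>2"
      using exp_bound[OF that] .
    moreover have "1 + y\<^sup>2 \<le> exp (y\<^sup>2)"
      by (rule exp_ge_add_one_self)
    ultimately show ?thesis by linarith
  qed
  show ?thesis
    using *[of x] *[of "- x"] assms by (cases "x \<ge> 0") auto
qed

lemma sum_Pow_split:
  assumes "finite I" "i \<in> I"
  shows "(\<Sum>z\<in>Pow I. g z) = (\<Sum>z\<in>Pow (I - {i}). g z) + (\<Sum>z\<in>Pow (I - {i}). g (insert i z))"
proof -
  have "Pow I = Pow (I - {i}) \<union> insert i ` Pow (I - {i})"
    using assms(2) by (metis Pow_insert insert_Diff)
  moreover have "inj_on (insert i) (Pow (I - {i}))"
    by (auto simp: inj_on_def)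
  ultimately show ?thesis
    using assms(1) by (subst (1) \<open>Pow I = _\<close>, subst sum.union_disjoint) (auto simp: sum.reindex)
qed

lemma card_Pow_remove:
  assumes "finite I" "i \<in> I"
  shows "real (card (Pow (I - {i}))) = 2 ^ card I / 2"
  using assms card_Diff_singleton[OF assms(2)] by (cases "card I") (auto simp: card_Pow)

text \<open>
  Jensen's inequality for \<open>exp\<close> under the density \<open>f\<close>, with the exponent tilted by half of the biases,
  against the moment generating function of the uniform distribution.
\<close>

lemma level_one_inequality:
  fixes f :: "'i set \<Rightarrow> real"
  assumes I: "finite I" and f: "\<And>z. z \<subseteq> I \<Longrightarrow> 0 \<le> f z \<and> f z \<le> 1"
    and pos: "0 < (\<Sum>z\<in>Pow I. f z)"
  shows "(\<Sum>i\<in>I. ((\<Sum>z\<in>Pow I. if i \<in> z then - f z else f z) / (\<Sum>z\<in>Pow I. f z))\<^sup>2)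
    \<le> 4 * ln (2 ^ card I / (\<Sum>z\<in>Pow I. f z))"
proof -
  define S where "S = (\<Sum>z\<in>Pow I. f z)"
  define \<beta> where "\<beta> i = (\<Sum>z\<in>Pow I. if i \<in> z then - f z else f z) / S" for i
  define \<epsilon> where "\<epsilon> i z = (if i \<in> z then - 1 else 1 :: real)" for i :: 'i and z
  \<comment> \<open>A tilt by \<open>c * \<beta> i\<close> would bound \<open>B * (c - c^2)\<close>
    by the logarithm; \<open>c = 1 / 2\<close> is optimal and gives the factor 4.\<close>
  define E where "E z = (\<Sum>i\<in>I. \<beta> i / 2 * \<epsilon> i z)" for z
  define B where "B = (\<Sum>i\<in>I. (\<beta> i)\<^sup>2)"
  have S: "0 < S" using pos by (simp add: S_def)
  have \<beta>: "\<beta> i * S = (\<Sum>z\<in>Pow I. f z * \<epsilon> i z)" for i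
    using S unfolding \<beta>_def \<epsilon>_def by (auto intro: sum.cong)
  have \<beta>_le: "\<bar>\<beta> i\<bar> \<le> 1" for i
  proof -
    have "\<bar>\<beta> i * S\<bar> \<le> (\<Sum>z\<in>Pow I. \<bar>f z * \<epsilon> i z\<bar>)"
      unfolding \<beta> by (rule sum_abs)
    also have "\<dots> = S"
      unfolding S_def using f by (intro sum.cong) (auto simp: \<epsilon>_def)
    finally show ?thesis using S by (simp add: abs_mult)
  qed
  have "(\<Sum>z\<in>Pow I. f z * E z) = (\<Sum>i\<in>I. \<beta> i / 2 * (\<Sum>z\<in>Pow I. f z * \<epsilon> i z))"
    unfolding E_def sum_distrib_left by (subst sum.swap) (simp add: algebra_simps)
  also have "\<dots> = B / 2 * S"
    unfolding \<beta>[symmetric] B_def by (simp add: sum_distrib_left sum_distrib_right sum_divide_distrib power2_eq_square mult_ac)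
  finally have fE: "(\<Sum>z\<in>Pow I. f z * E z) = B / 2 * S" .
  \<comment> \<open>Jensen in tangent form: under the density \<open>f / S\<close> the mean of
    \<open>E\<close> is \<open>B / 2\<close>, so the linear part of the tangent to
    \<open>exp\<close> at \<open>B / 2\<close> averages to zero.\<close>
  have "exp (B / 2) * S = (\<Sum>z\<in>Pow I. f z * (exp (B / 2) * (1 + (E z - B / 2))))"
  proof -
    have "(\<Sum>z\<in>Pow I. f z * (exp (B / 2) * (1 + (E z - B / 2))))
      = exp (B / 2) * ((\<Sum>z\<in>Pow I. f z) + (\<Sum>z\<in>Pow I. f z * E z) - B / 2 * (\<Sum>z\<in>Pow I. f z))"
      unfolding sum_distrib_left sum.distrib[symmetric] sum_subtractf[symmetric]
      by (intro sum.cong) (simp_all add: algebra_simps)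
    then show ?thesis using fE by (simp add: S_def)
  qed
  also have "\<dots> \<le> (\<Sum>z\<in>Pow I. 1 * exp (E z))"
  proof (intro sum_mono)
    fix z assume z: "z \<in> Pow I"
    have "exp (B / 2) * (1 + (E z - B / 2)) \<le> exp (B / 2) * exp (E z - B / 2)"
      by (intro mult_left_mono exp_ge_add_one_self) auto
    then have "exp (B / 2) * (1 + (E z - B / 2)) \<le> exp (E z)"
      by (simp add: exp_diff)
    then have "f z * (exp (B / 2) * (1 + (E z - B / 2))) \<le> f z * exp (E z)"
      using f z by (intro mult_left_mono) auto
    also have "\<dots> \<le> 1 * exp (E z)"
      using f z by (intro mult_right_mono) auto
    finally show "f z * (exp (B / 2) * (1 + (E z - B / 2))) \<le> 1 * exp (E z)" .
  qed
  \<comment> \<open>As \<open>exp (E z)\<close> is a product over coordinates, the sum over all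
    \<open>z\<close> becomes a product of two-term sums.\<close>
  also have "\<dots> = (\<Sum>z\<in>Pow I. (\<Prod>i\<in>z. exp (- (\<beta> i / 2))) * (\<Prod>i\<in>I - z. exp (\<beta> i / 2)))"
  proof (intro sum.cong refl)
    fix z assume "z \<in> Pow I"
    then have z: "z \<subseteq> I" by simp
    have "E z = (\<Sum>i\<in>I - z. \<beta> i / 2) + (\<Sum>i\<in>z. - (\<beta> i / 2))"
      unfolding E_def \<epsilon>_def using sum.subset_diff[OF z I, of "\<lambda>i. \<beta> i / 2 * (if i \<in> z then - 1 else 1)"] by simp
    then show "1 * exp (E z) = (\<Prod>i\<in>z. exp (- (\<beta> i / 2))) * (\<Prod>i\<in>I - z. exp (\<beta> i / 2))"
      using I z by (simp add: exp_add exp_sum finite_subset)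
  qed
  also have "\<dots> = (\<Prod>i\<in>I. exp (- (\<beta> i / 2)) + exp (\<beta> i / 2))"
    by (rule prod_add[symmetric]) (rule I)
  also have "\<dots> \<le> (\<Prod>i\<in>I. 2 * exp ((\<beta> i / 2)\<^sup>2))"
    using \<beta>_le by (intro prod_mono conjI exp_plus_exp_minus_le) (auto simp: add_nonneg_nonneg order_trans[OF \<beta>_le])
  also have "\<dots> = 2 ^ card I * exp (B / 4)"
    using I by (simp add: prod.distrib exp_sum[symmetric] B_def sum_divide_distrib power_divide)
  finally have "exp (B / 4) * (exp (B / 4) * S) \<le> exp (B / 4) * 2 ^ card I"
    by (simp add: exp_add[symmetric] algebra_simps flip: mult.assoc)
  then have "exp (B / 4) \<le> 2 ^ card I / S"
    using S by (simp add: field_simps)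
  then have "B / 4 \<le> ln (2 ^ card I / S)"
    using S by (subst ln_ge_iff) simp_all
  then show ?thesis by (simp add: B_def \<beta>_def S_def)
qed

text \<open>Think of \<open>f z\<close> as the probability of one fixed transcript on input
  \<open>z\<close>. Writing \<open>p\<close> and \<open>q\<close> for the two sums at
  \<open>i\<close> and \<open>S = p + q\<close>, the bound
  \<open>(sqrt p + sqrt q)^2 \<ge> S\<close> makes each term at most \<open>(p - q)^2 / S\<close>,
  which is \<open>S\<close> times the squared bias of coordinate \<open>i\<close>.\<close>

lemma sum_hellinger_le:
  fixes f :: "'i set \<Rightarrow> real"
  assumes I: "finite I" and f: "\<And>z. z \<subseteq> I \<Longrightarrow> 0 \<le> f z \<and> f z \<le> 1"
  shows "(\<Sum>i\<in>I. (sqrt (\<Sum>z\<in>Pow (I - {i}). f z) - sqrt (\<Sum>z\<in>Pow (I - {i}). f (insert i z)))\<^sup>2)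
    \<le> 4 * ((\<Sum>z\<in>Pow I. f z) * ln (2 ^ card I / (\<Sum>z\<in>Pow I. f z)))"
proof -
  define S where "S = (\<Sum>z\<in>Pow I. f z)"
  define p where "p i = (\<Sum>z\<in>Pow (I - {i}). f z)" for i
  define q where "q i = (\<Sum>z\<in>Pow (I - {i}). f (insert i z))" for i
  have p: "0 \<le> p i" and q: "i \<in> I \<Longrightarrow> 0 \<le> q i" for i
    unfolding p_def q_def by (auto intro!: sum_nonneg conjunct1[OF f])
  have pq: "p i + q i = S" if "i \<in> I" for i
    unfolding p_def q_def S_def using sum_Pow_split[OF I that, of f] by simp
  have S: "0 \<le> S" unfolding S_def using f by (auto intro!: sum_nonneg)
  have "(\<Sum>i\<in>I. (sqrt (p i) - sqrt (q i))\<^sup>2) \<le> 4 * (S * ln (2 ^ card I / S))"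
  proof (cases "S = 0")
    case True
    then have "p i = 0 \<and> q i = 0" if "i \<in> I" for i
      using p[of i] q[OF that] pq[OF that] by linarith
    then show ?thesis using True by simp
  next
    case False
    then have S: "0 < S" using S by simp
    have "(sqrt (p i) - sqrt (q i))\<^sup>2 \<le> S * ((\<Sum>z\<in>Pow I. if i \<in> z then - f z else f z) / S)\<^sup>2"
      if i: "i \<in> I" for i
    proof -
      have d: "(\<Sum>z\<in>Pow I. if i \<in> z then - f z else f z) = p i - q i"
      proof -
        have "(\<Sum>z\<in>Pow (I - {i}). if i \<in> z then - f z else f z) = p i"
          unfolding p_def by (intro sum.cong) auto
        then show ?thesis
          unfolding sum_Pow_split[OF I i] by (simp add: q_def sum_negf)
      qed
      have "(sqrt (p i) - sqrt (q i))\<^sup>2 * S \<le> (sqrt (p i) - sqrt (q i))\<^sup>2 * (sqrt (p i) + sqrt (q i))\<^sup>2"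
        using p[of i] q[OF i] pq[OF i] by (intro mult_left_mono) (auto simp: power2_sum)
      also have "\<dots> = (p i - q i)\<^sup>2"
        using p[of i] q[OF i] by (simp add: power_mult_distrib[symmetric] algebra_simps)
      finally have "(sqrt (p i) - sqrt (q i))\<^sup>2 \<le> (p i - q i)\<^sup>2 / S"
        using S by (simp add: pos_le_divide_eq)
      then show ?thesis
        using S unfolding d by (simp add: power_divide power2_eq_square)
    qed
    then have "(\<Sum>i\<in>I. (sqrt (p i) - sqrt (q i))\<^sup>2)
        \<le> S * (\<Sum>i\<in>I. ((\<Sum>z\<in>Pow I. if i \<in> z then - f z else f z) / S)\<^sup>2)"
      unfolding sum_distrib_left by (intro sum_mono) auto
    also have "\<dots> \<le> S * (4 * ln (2 ^ card I / S))"
      using S unfolding S_def by (intro mult_left_mono level_one_inequality I f) auto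
    finally show ?thesis by simp
  qed
  then show ?thesis by (simp add: p_def q_def S_def)
qed

text \<open>The left side is \<open>M\<close> times the entropy of the distribution
  \<open>S / M\<close>, which is largest for the uniform distribution.\<close>

lemma entropy_le_ln_card:
  fixes S :: "'t \<Rightarrow> real"
  assumes T: "finite T" and S: "\<And>t. t \<in> T \<Longrightarrow> 0 \<le> S t" and sum: "(\<Sum>t\<in>T. S t) = M" and M: "0 < M"
  shows "(\<Sum>t\<in>T. S t * ln (M / S t)) \<le> M * ln (card T)"
proof -
  have T0: "0 < real (card T)"
    using T sum M by (auto simp: card_gt_0_iff)
  \<comment> \<open>The corrections \<open>M / card T - S t\<close> sum to zero over
    \<open>T\<close>.\<close>
  have "S t * ln (M / S t) \<le> S t * ln (card T) + (M / card T - S t)" if t: "t \<in> T" for t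
  proof (cases "S t = 0")
    case False
    then have St: "0 < S t" using S[OF t] by simp
    have "ln (M / S t) - ln (card T) = ln (M / (card T * S t))"
      using M T0 St by (simp add: ln_div ln_mult)
    also have "\<dots> \<le> M / (card T * S t) - 1"
      using M T0 St by (intro ln_le_minus_one) auto
    finally have "S t * (ln (M / S t) - ln (card T)) \<le> S t * (M / (card T * S t) - 1)"
      using St by (intro mult_left_mono) auto
    then show ?thesis using St by (simp add: algebra_simps)
  qed (use M in auto)
  then have "(\<Sum>t\<in>T. S t * ln (M / S t)) \<le> (\<Sum>t\<in>T. S t * ln (card T) + (M / card T - S t))"
    by (rule sum_mono)
  also have "\<dots> = M * ln (card T)"
    using T0 sum by (simp add: sum.distrib sum_subtractf sum_distrib_right[symmetric])
  finally show ?thesis .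
qed

section \<open>Transcripts that separate disjoint from intersecting inputs\<close>

text \<open>The inputs \<open>z \<inter> d\<close> and \<open>z - d\<close> are disjoint, and
  inserting \<open>i\<close> into both makes \<open>i\<close> their only common point. With
  \<open>v t\<close> as the probability of accepting after \<open>t\<close>, the left side adds up
  the gaps in acceptance probability, so large gaps force many transcripts.\<close>

lemma disjointness_transcripts:
  fixes a b :: "'t \<Rightarrow> 'i set \<Rightarrow> real" and v :: "'t \<Rightarrow> real"
  assumes I: "finite I" and T: "finite T"
    and ab: "\<And>t x. t \<in> T \<Longrightarrow> 0 \<le> a t x" "\<And>t y. t \<in> T \<Longrightarrow> 0 \<le> b t y"
    and sum: "\<And>x y. (\<Sum>t\<in>T. a t x * b t y) = 1"
    and v: "\<And>t. t \<in> T \<Longrightarrow> 0 \<le> v t \<and> v t \<le> 1"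
  shows "(\<Sum>i\<in>I. \<Sum>d\<in>Pow (I - {i}). \<Sum>z\<in>Pow (I - {i}).
      (\<Sum>t\<in>T. a t (z \<inter> d) * b t (z - d) * v t)
      - (\<Sum>t\<in>T. a t (insert i (z \<inter> d)) * b t (insert i (z - d)) * v t))
    \<le> 4 ^ card I * (12 * ln (card T) + card I / 24)"
proof -
  define m where "m = (2::real) ^ card I"
  \<comment> \<open>Unnormalised law of the transcript for random \<open>z\<close> outside
    \<open>i\<close>, where \<open>U\<close> and \<open>V\<close>, each \<open>{}\<close> or
    \<open>{i}\<close>, are what the two players hold at \<open>i\<close>. Its total mass is
    \<open>m / 2\<close>.\<close>
  define R where "R i d U V t = (\<Sum>z\<in>Pow (I - {i}). a t (z \<inter> d \<union> U) * b t (z - d \<union> V))"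
    for i d U V t
  define H where "H P Q = (\<Sum>t\<in>T. (sqrt (P t) - sqrt (Q t))\<^sup>2)" for P Q :: "'t \<Rightarrow> real"
  have R_nonneg: "0 \<le> R i d U V t" if "t \<in> T" for i d U V t
    unfolding R_def using ab that by (intro sum_nonneg mult_nonneg_nonneg) auto
  have R_total: "(\<Sum>t\<in>T. R i d U V t) = m / 2" if "i \<in> I" for i d U V
  proof -
    have "(\<Sum>t\<in>T. R i d U V t) = real (card (Pow (I - {i})))"
      unfolding R_def by (subst sum.swap) (simp add: sum)
    also have "\<dots> = m / 2"
      using card_Pow_remove[OF I that] by (simp add: m_def)
    finally show ?thesis .
  qed
  have R_split: "R i d U V t = (\<Sum>x\<in>Pow d. a t (x \<union> U)) * (\<Sum>y\<in>Pow (I - {i} - d). b t (y \<union> V))"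
    if d: "d \<subseteq> I - {i}" for i d U V t
  proof -
    have "R i d U V t = (\<Sum>(x, y)\<in>Pow d \<times> Pow (I - {i} - d). a t (x \<union> U) * b t (y \<union> V))"
      unfolding R_def using d
      by (intro sum.reindex_bij_witness[where i = "\<lambda>(x, y). x \<union> y" and j = "\<lambda>z. (z \<inter> d, z - d)"])
        (auto intro!: arg_cong2[where f = "(*)"] arg_cong[where f = "a t"] arg_cong[where f = "b t"])
    then show ?thesis
      by (simp add: sum_product sum.cartesian_product)
  qed
  text \<open>
    For fixed \<open>d\<close> the inputs \<open>z \<inter> d\<close> and \<open>z - d\<close> are independent, so \<open>R\<close>, like a single transcript
    probability, is a product of a factor depending on \<open>U\<close> and a factor depending on \<open>V\<close>.
  \<close>
  have cut_paste: "H (R i d {} {}) (R i d {i} {i}) = H (R i d {} {i}) (R i d {i} {})"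
    if i: "i \<in> I" and d: "d \<subseteq> I - {i}" for i d
  proof -
    \<comment> \<open>Because the masses agree, \<open>H\<close> depends only on the pointwise
      products of the two laws, and both pairs in the claim yield the same four factors.\<close>
    have H_eq: "H (R i d U V) (R i d U' V') = m - 2 * (\<Sum>t\<in>T. sqrt (R i d U V t * R i d U' V' t))"
      for U V U' V'
    proof -
      have "H (R i d U V) (R i d U' V')
        = (\<Sum>t\<in>T. R i d U V t + R i d U' V' t - 2 * sqrt (R i d U V t * R i d U' V' t))"
        unfolding H_def using R_nonneg by (intro sum.cong) (auto simp: power2_diff real_sqrt_mult)
      then show ?thesis
        using R_total[OF i] by (simp add: sum.distrib sum_subtractf sum_distrib_left)
    qed
    show ?thesis
      unfolding H_eq R_split[OF d] by (simp add: mult_ac)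
  qed
  have H_triangle: "H P Q \<le> 2 * (H S P + H S Q)" for P Q S
  proof -
    have "(p - q)\<^sup>2 \<le> 2 * ((s - p)\<^sup>2 + (s - q)\<^sup>2)" for p q s :: real
      using zero_le_power2[of "2 * s - p - q"] by (simp add: power2_eq_square algebra_simps)
    then show ?thesis
      unfolding H_def sum.distrib[symmetric] sum_distrib_left by (intro sum_mono)
  qed
  \<comment> \<open>Equal masses allow \<open>v\<close> to be shifted by \<open>1 / 2\<close>, and
    AM-GM does the rest. Its weights leave the error \<open>m / 12\<close>, half of the gap
    \<open>(m / 2) / 3\<close> that a correct protocol must show.\<close>
  have advantage: "(\<Sum>t\<in>T. (P t - Q t) * v t) \<le> 3 / 2 * H P Q + m / 12"
    if P: "\<And>t. t \<in> T \<Longrightarrow> 0 \<le> P t" "sum P T = m / 2" and Q: "\<And>t. t \<in> T \<Longrightarrow> 0 \<le> Q t" "sum Q T = m / 2"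
    for P Q
  proof -
    have "(\<Sum>t\<in>T. (P t - Q t) * v t) = (\<Sum>t\<in>T. (P t - Q t) * (v t - 1 / 2))"
    proof -
      have "(\<Sum>t\<in>T. (P t - Q t) * (v t - 1 / 2)) = (\<Sum>t\<in>T. (P t - Q t) * v t) - (sum P T - sum Q T) / 2"
        unfolding sum_subtractf[symmetric] sum_divide_distrib by (intro sum.cong) (simp_all add: field_simps)
      then show ?thesis using P Q by simp
    qed
    also have "\<dots> \<le> (\<Sum>t\<in>T. 3 / 2 * (sqrt (P t) - sqrt (Q t))\<^sup>2 + (P t + Q t) / 12)"
    proof (intro sum_mono)
      fix t assume t: "t \<in> T"
      define p q where "p = sqrt (P t)" and "q = sqrt (Q t)"
      have pq: "P t = p\<^sup>2" "Q t = q\<^sup>2" "0 \<le> p" "0 \<le> q"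
        using P Q t by (auto simp: p_def q_def)
      have "(P t - Q t) * (v t - 1 / 2) \<le> \<bar>P t - Q t\<bar> * \<bar>v t - 1 / 2\<bar>"
        by (metis abs_ge_self abs_mult)
      also have "\<dots> \<le> \<bar>P t - Q t\<bar> * (1 / 2)"
      proof (rule mult_left_mono)
        show "\<bar>v t - 1 / 2\<bar> \<le> 1 / 2" using v[OF t] by linarith
      qed simp
      also have "\<dots> = \<bar>p - q\<bar> * (p + q) / 2"
      proof -
        have "P t - Q t = (p - q) * (p + q)"
          by (simp add: pq algebra_simps power2_eq_square)
        then show ?thesis using pq by (simp add: abs_mult)
      qed
      also have "\<dots> \<le> 3 / 2 * (p - q)\<^sup>2 + (p + q)\<^sup>2 / 24"
      proof -
        have "x * y / 2 \<le> 3 / 2 * x\<^sup>2 + y\<^sup>2 / 24" for x y :: real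
          using zero_le_power2[of "6 * x - y"] by (simp add: power2_eq_square algebra_simps)
        from this[of "\<bar>p - q\<bar>" "p + q"] show ?thesis by simp
      qed
      also have "\<dots> \<le> 3 / 2 * (p - q)\<^sup>2 + (P t + Q t) / 12"
        using zero_le_power2[of "p - q"] by (simp add: pq power2_sum power2_diff)
      finally show "(P t - Q t) * (v t - 1 / 2) \<le> 3 / 2 * (sqrt (P t) - sqrt (Q t))\<^sup>2 + (P t + Q t) / 12"
        by (simp add: p_def q_def)
    qed
    also have "\<dots> = 3 / 2 * H P Q + m / 12"
      using P Q by (simp add: H_def sum.distrib sum_distrib_left sum_divide_distrib[symmetric])
    finally show ?thesis .
  qed
  have ab_le: "a t x * b t y \<le> 1" if "t \<in> T" for t x y
    using member_le_sum[of t T "\<lambda>t. a t x * b t y"] that T ab sum[of x y] by auto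
  \<comment> \<open>For fixed \<open>d\<close>, the Hellinger bound is applied to each transcript
    separately; summed over \<open>t\<close>, the right sides form an entropy.\<close>
  have info: "(\<Sum>i\<in>I. H (\<lambda>t. \<Sum>z\<in>Pow (I - {i}). a t (z \<inter> d) * b t (z - d))
      (\<lambda>t. \<Sum>z\<in>Pow (I - {i}). a t (insert i z \<inter> d) * b t (insert i z - d)))
    \<le> 4 * m * ln (card T)" (is "?L \<le> _") for d
  proof -
    define S where "S t = (\<Sum>z\<in>Pow I. a t (z \<inter> d) * b t (z - d))" for t
    have "sum S T = real (card (Pow I))"
      unfolding S_def by (subst sum.swap) (simp add: sum)
    then have S: "sum S T = m"
      using I by (simp add: card_Pow m_def)
    have "?L \<le> (\<Sum>t\<in>T. 4 * (S t * ln (m / S t)))"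
      unfolding H_def m_def S_def
      by (subst sum.swap, intro sum_mono sum_hellinger_le I conjI mult_nonneg_nonneg ab ab_le)
    also have "\<dots> \<le> 4 * (m * ln (card T))"
      unfolding sum_distrib_left[symmetric] using ab S
      by (intro mult_left_mono entropy_le_ln_card T) (auto simp: S_def m_def intro!: sum_nonneg)
    finally show ?thesis by simp
  qed
  \<comment> \<open>Both laws are compared with the one where nobody holds \<open>i\<close>.\<close>
  have "(\<Sum>i\<in>I. \<Sum>d\<in>Pow (I - {i}). H (R i d {} {i}) (R i d {i} {}))
    \<le> (\<Sum>i\<in>I. \<Sum>d\<in>Pow (I - {i}). 2 * (H (R i d {} {}) (R i d {} {i}) + H (R i d {} {}) (R i d {i} {})))"
    by (intro sum_mono H_triangle)
  \<comment> \<open>The two distances are one expression at \<open>d\<close> and at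
    \<open>insert i d\<close>: membership of \<open>i\<close> in \<open>d\<close> decides which
    player receives coordinate \<open>i\<close>. Hence they merge into a sum over all subsets of
    \<open>I\<close>, to which \<open>info\<close> applies.\<close>
  also have "\<dots> = 2 * (\<Sum>i\<in>I. \<Sum>d\<in>Pow I. H (\<lambda>t. \<Sum>z\<in>Pow (I - {i}). a t (z \<inter> d) * b t (z - d))
      (\<lambda>t. \<Sum>z\<in>Pow (I - {i}). a t (insert i z \<inter> d) * b t (insert i z - d)))"
    unfolding sum_distrib_left
  proof (rule sum.cong[OF refl])
    fix i assume i: "i \<in> I"
    have 1: "H (\<lambda>t. \<Sum>z\<in>Pow (I - {i}). a t (z \<inter> d) * b t (z - d))
        (\<lambda>t. \<Sum>z\<in>Pow (I - {i}). a t (insert i z \<inter> d) * b t (insert i z - d))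
      = H (R i d {} {}) (R i d {} {i})" if "d \<in> Pow (I - {i})" for d
    proof -
      have "insert i z \<inter> d = z \<inter> d \<union> {}" "insert i z - d = z - d \<union> {i}" for z
        using that by auto
      then show ?thesis unfolding R_def by simp
    qed
    have 2: "H (\<lambda>t. \<Sum>z\<in>Pow (I - {i}). a t (z \<inter> insert i d) * b t (z - insert i d))
        (\<lambda>t. \<Sum>z\<in>Pow (I - {i}). a t (insert i z \<inter> insert i d) * b t (insert i z - insert i d))
      = H (R i d {} {}) (R i d {i} {})" for d
    proof -
      have "z \<inter> insert i d = z \<inter> d \<union> {} \<and> z - insert i d = z - d \<union> {} \<and>
          insert i z \<inter> insert i d = z \<inter> d \<union> {i} \<and> insert i z - insert i d = z - d \<union> {}"
        if "z \<in> Pow (I - {i})" for z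
        using that by auto
      then show ?thesis
        unfolding R_def by (intro arg_cong2[where f = H] ext sum.cong refl) simp_all
    qed
    show "(\<Sum>d\<in>Pow (I - {i}). 2 * (H (R i d {} {}) (R i d {} {i}) + H (R i d {} {}) (R i d {i} {})))
      = (\<Sum>d\<in>Pow I. 2 * H (\<lambda>t. \<Sum>z\<in>Pow (I - {i}). a t (z \<inter> d) * b t (z - d))
      (\<lambda>t. \<Sum>z\<in>Pow (I - {i}). a t (insert i z \<inter> d) * b t (insert i z - d)))"
      unfolding sum_Pow_split[OF I i] 2 by (simp add: 1 sum.distrib sum_distrib_left)
  qed
  also have "\<dots> \<le> 2 * (\<Sum>d\<in>Pow I. 4 * m * ln (card T))"
    by (subst sum.swap) (intro mult_left_mono sum_mono info, simp)
  also have "\<dots> = 4 ^ card I * (8 * ln (card T))"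
    using I by (simp add: card_Pow m_def power_mult_distrib[symmetric])
  finally have hellinger: "(\<Sum>i\<in>I. \<Sum>d\<in>Pow (I - {i}). H (R i d {} {i}) (R i d {i} {}))
    \<le> 4 ^ card I * (8 * ln (card T))" .
  have "(\<Sum>i\<in>I. \<Sum>d\<in>Pow (I - {i}). \<Sum>z\<in>Pow (I - {i}).
      (\<Sum>t\<in>T. a t (z \<inter> d) * b t (z - d) * v t)
      - (\<Sum>t\<in>T. a t (insert i (z \<inter> d)) * b t (insert i (z - d)) * v t))
    = (\<Sum>i\<in>I. \<Sum>d\<in>Pow (I - {i}). \<Sum>t\<in>T. (R i d {} {} t - R i d {i} {i} t) * v t)"
  proof (rule sum.cong[OF refl], rule sum.cong[OF refl])
    fix i d
    show "(\<Sum>z\<in>Pow (I - {i}). (\<Sum>t\<in>T. a t (z \<inter> d) * b t (z - d) * v t)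
        - (\<Sum>t\<in>T. a t (insert i (z \<inter> d)) * b t (insert i (z - d)) * v t))
      = (\<Sum>t\<in>T. (R i d {} {} t - R i d {i} {i} t) * v t)"
      unfolding R_def sum_subtractf[symmetric]
      by (subst sum.swap) (simp add: sum_distrib_right sum_subtractf left_diff_distrib)
  qed
  also have "\<dots> \<le> (\<Sum>i\<in>I. \<Sum>d\<in>Pow (I - {i}). 3 / 2 * H (R i d {} {i}) (R i d {i} {}) + m / 12)"
    using advantage R_nonneg R_total by (intro sum_mono) (simp add: cut_paste[symmetric])
  also have "\<dots> = 3 / 2 * (\<Sum>i\<in>I. \<Sum>d\<in>Pow (I - {i}). H (R i d {} {i}) (R i d {i} {}))
      + (\<Sum>i\<in>I. \<Sum>d\<in>Pow (I - {i}). m / 12)"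
    by (simp add: sum.distrib sum_distrib_left)
  also have "(\<Sum>i\<in>I. \<Sum>d\<in>Pow (I - {i}). m / 12) = (\<Sum>i\<in>I. 4 ^ card I / 24)"
  proof (intro sum.cong refl)
    fix i assume i: "i \<in> I"
    have "(\<Sum>d\<in>Pow (I - {i}). m / 12) = real (card (Pow (I - {i}))) * (m / 12)"
      by simp
    then show "(\<Sum>d\<in>Pow (I - {i}). m / 12) = 4 ^ card I / 24"
      unfolding card_Pow_remove[OF I i] m_def by (simp add: power_mult_distrib[symmetric])
  qed
  finally show ?thesis
    using hellinger by (simp add: algebra_simps)
qed

section \<open>Streaming algorithms as protocols\<close>

text \<open>
  The list \<open>m # t\<close> is a transcript of \<open>j + 1\<close> memory contents, the most recent one first.
\<close>

definition factorizes :: "'m set \<Rightarrow> nat \<Rightarrow> ('x \<Rightarrow> 'y \<Rightarrow> 'm pmf) \<Rightarrow> bool" where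
  "factorizes M j P \<longleftrightarrow> (\<exists>a b. (\<forall>t x. 0 \<le> a t x) \<and> (\<forall>t y. 0 \<le> b t y) \<and>
     (\<forall>x y. \<forall>m\<in>M. pmf (P x y) m =
        (\<Sum>t | set t \<subseteq> M \<and> length t = j. a (m # t) x * b (m # t) y :: real)))"

lemma sum_lists_length_Suc:
  "(\<Sum>t | set t \<subseteq> M \<and> length t = Suc j. g t)
    = (\<Sum>m\<in>M. \<Sum>t | set t \<subseteq> M \<and> length t = j. g (m # t))"
proof -
  have "{t. set t \<subseteq> M \<and> length t = Suc j}
      = (\<lambda>(m, t). m # t) ` (M \<times> {t. set t \<subseteq> M \<and> length t = j})"
    by (auto simp: length_Suc_conv image_iff)
  then show ?thesis
    by (simp add: sum.reindex inj_on_def sum.cartesian_product split_def)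
qed

lemma pmf_bind_finite:
  assumes "finite M" "set_pmf P \<subseteq> M"
  shows "pmf (bind_pmf P K) x = (\<Sum>m\<in>M. pmf P m * pmf (K m) x)"
  unfolding pmf_bind using assms by (subst integral_measure_pmf) (auto simp: set_pmf_iff)

lemma factorizes_const: "factorizes M 0 (\<lambda>x y. D)"
proof -
  have "{t. set t \<subseteq> M \<and> length t = 0} = {[]}" by auto
  then show ?thesis
    unfolding factorizes_def
    by (intro exI[of _ "\<lambda>t x. pmf D (hd t)"] exI[of _ "\<lambda>t y. 1"]) simp
qed

lemma factorizes_swap:
  assumes "factorizes M j P"
  shows "factorizes M j (\<lambda>y x. P x y)"
proof -
  from assms obtain a b where "\<forall>t x. 0 \<le> a t x" "\<forall>t y. 0 \<le> b t y"
    "\<forall>x y. \<forall>m\<in>M. pmf (P x y) m = (\<Sum>t | set t \<subseteq> M \<and> length t = j. a (m # t) x * b (m # t) y)"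
    unfolding factorizes_def by blast
  then show ?thesis
    unfolding factorizes_def by (intro exI[of _ b] exI[of _ a]) (simp add: mult.commute)
qed

text \<open>The new content depends only on the old one, now at \<open>hd t\<close>, and on
  \<open>x\<close>, so the transition probability is absorbed by the factor for
  \<open>x\<close>.\<close>

lemma factorizes_bind_left:
  assumes "factorizes M j P" and M: "finite M" and supp: "\<And>x y. set_pmf (P x y) \<subseteq> M"
  shows "factorizes M (Suc j) (\<lambda>x y. bind_pmf (P x y) (K x))"
proof -
  from assms(1) obtain a b where ab: "\<forall>t x. 0 \<le> a t x" "\<forall>t y. 0 \<le> b t y"
    and P: "\<forall>x y. \<forall>m\<in>M. pmf (P x y) m = (\<Sum>t | set t \<subseteq> M \<and> length t = j. a (m # t) x * b (m # t) y)"
    unfolding factorizes_def by blast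
  have "pmf (bind_pmf (P x y) (K x)) m' = (\<Sum>t | set t \<subseteq> M \<and> length t = Suc j.
      a t x * pmf (K x (hd t)) m' * b t y)" for x y m'
    unfolding pmf_bind_finite[OF M supp] sum_lists_length_Suc
    using P by (simp add: sum_distrib_left sum_distrib_right mult_ac)
  then show ?thesis
    unfolding factorizes_def using ab
    by (intro exI[of _ "\<lambda>t x. a (tl t) x * pmf (K x (hd (tl t))) (hd t)"] exI[of _ "\<lambda>t y. b (tl t) y"]) auto
qed

lemma factorizes_bind_right:
  assumes "factorizes M j P" "finite M" "\<And>x y. set_pmf (P x y) \<subseteq> M"
  shows "factorizes M (Suc j) (\<lambda>x y. bind_pmf (P x y) (K y))"
  using factorizes_swap[OF factorizes_bind_left[OF factorizes_swap[OF assms(1)]]] assms(2,3) by blast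

section \<open>Multi-pass runs as two-player protocols\<close>

lemma read_edges_append:
  "read_edges f (xs @ ys) m = bind_pmf (read_edges f xs m) (read_edges f ys)"
proof (induction xs arbitrary: m)
  case (Cons e xs)
  then have "read_edges f (xs @ ys) = (\<lambda>m. bind_pmf (read_edges f xs m) (read_edges f ys))"
    by (intro ext)
  then show ?case by (simp add: bind_assoc_pmf)
qed (simp add: bind_return_pmf)

lemma prefix_subset_memory_contents:
  assumes "r \<in> set_pmf (tape A)" "i < p" "t \<le> length es"
  shows "set_pmf (bind_pmf (after_passes A r es i) (read_edges (step A r i) (take t es)))
    \<subseteq> memory_contents A p es"
proof
  fix m
  assume m: "m \<in> set_pmf (bind_pmf (after_passes A r es i) (read_edges (step A r i) (take t es)))"
  have it: "i \<in> {..<p}" "t \<in> {..length es}" using assms by auto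
  show "m \<in> memory_contents A p es"
    unfolding memory_contents_def
    by (rule UN_I[OF assms(1)], rule UnI2, rule UN_I[OF it(1)], rule UN_I[OF it(2)], rule m)
qed

lemma after_passes_subset_memory_contents:
  assumes r: "r \<in> set_pmf (tape A)" and i: "i \<le> p"
  shows "set_pmf (after_passes A r es i) \<subseteq> memory_contents A p es"
proof (cases "i = p")
  case True
  then show ?thesis
    unfolding memory_contents_def using r by blast
next
  case False
  have "read_edges (step A r i) (take 0 es) = return_pmf"
    by (intro ext) simp
  then show ?thesis
    using prefix_subset_memory_contents[of r A i p 0 es] r i False by (simp add: bind_return_pmf')
qed

lemma mid_pass_subset_memory_contents:
  assumes "r \<in> set_pmf (tape A)" "i < p"
  shows "set_pmf (bind_pmf (after_passes A r (xs @ ys) i) (read_edges (step A r i) xs))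
    \<subseteq> memory_contents A p (xs @ ys)"
  using prefix_subset_memory_contents[OF assms, of "length xs" "xs @ ys"] by simp

text \<open>Each pass costs two messages: Alice reads \<open>f x\<close> and hands over the memory,
  then Bob reads \<open>g y\<close> and ends the pass. The tape is shared randomness, so it is held
  fixed here.\<close>

lemma factorizes_after_passes:
  assumes r: "r \<in> set_pmf (tape A)" and M: "finite M"
    and space: "\<And>x y. memory_contents A p (f x @ g y) \<subseteq> M" and "i \<le> p"
  shows "factorizes M (2 * i) (\<lambda>x y. after_passes A r (f x @ g y) i)"
  using \<open>i \<le> p\<close>
proof (induction i)
  case 0
  show ?case by (simp add: factorizes_const)
next
  case (Suc i)
  then have i: "i \<le> p" "i < p" by auto
  define Q where "Q x y = bind_pmf (after_passes A r (f x @ g y) i) (read_edges (step A r i) (f x))" for x y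
  have "factorizes M (Suc (2 * i)) Q"
    unfolding Q_def
  proof (rule factorizes_bind_left[OF Suc.IH[OF i(1)] M])
    show "set_pmf (after_passes A r (f x @ g y) i) \<subseteq> M" for x y
      using after_passes_subset_memory_contents[OF r i(1)] space by blast
  qed
  then have "factorizes M (Suc (Suc (2 * i)))
      (\<lambda>x y. bind_pmf (Q x y) (\<lambda>m. bind_pmf (read_edges (step A r i) (g y) m) (pass_end A r i)))"
  proof (rule factorizes_bind_right[OF _ M])
    show "set_pmf (Q x y) \<subseteq> M" for x y
      unfolding Q_def using mid_pass_subset_memory_contents[OF r i(2)] space by blast
  qed
  moreover have "bind_pmf (Q x y) (\<lambda>m. bind_pmf (read_edges (step A r i) (g y) m) (pass_end A r i))
      = after_passes A r (f x @ g y) (Suc i)" for x y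
    unfolding Q_def by (simp add: bind_assoc_pmf read_edges_append)
  ultimately show ?case by (simp only: mult_Suc_right add_2_eq_Suc)
qed

section \<open>Counting transcripts and averaging over the tape\<close>

lemma finite_bool_lists: "finite {m :: bool list. length m \<le> s}"
  using finite_lists_length_le[of "UNIV :: bool set" s] by simp

text \<open>This form equals 1 at \<open>s = 0\<close>, so its logarithm is proportional to
  \<open>s\<close> with no additive term.\<close>

lemma card_bool_lists_le: "card {m :: bool list. length m \<le> s} \<le> 4 ^ s"
proof -
  have "card {m :: bool list. length m \<le> s} = (\<Sum>i\<le>s. 2 ^ i)"
    using card_lists_length_le[of "UNIV :: bool set" s] by simp
  also have "(\<Sum>i\<le>s. 2 ^ i) \<le> (4 :: nat) ^ s"
  proof (induction s)
    case (Suc s)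
    have "(2 :: nat) ^ s \<le> 4 ^ s" by (rule power_mono) auto
    then show ?case using Suc by simp
  qed simp
  finally show ?thesis .
qed

lemma streaming_disjointness_lower_bound:
  fixes f g :: "'i set \<Rightarrow> nat set list"
  assumes I: "finite I"
    and space: "\<And>x y. memory_contents A p (f x @ g y) \<subseteq> {m. length m \<le> s}"
    and disjoint: "\<And>x y. x \<subseteq> I \<Longrightarrow> y \<subseteq> I \<Longrightarrow> x \<inter> y = {} \<Longrightarrow> 2 / 3 \<le> pmf (answer A p (f x @ g y)) True"
    and intersect: "\<And>x y. x \<subseteq> I \<Longrightarrow> y \<subseteq> I \<Longrightarrow> x \<inter> y \<noteq> {} \<Longrightarrow> 2 / 3 \<le> pmf (answer A p (f x @ g y)) False"
  shows "real (card I) \<le> 288 * (real (s * (2 * p + 1)) * ln 4)"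
proof -
  define M where "M = {m :: bool list. length m \<le> s}"
  \<comment> \<open>The initial content and two more per pass.\<close>
  define T where "T = {t. set t \<subseteq> M \<and> length t = Suc (2 * p)}"
  define C where "C = 4 ^ card I * (12 * ln (card T) + card I / 24)"
  define acc where "acc r x y = pmf (bind_pmf (after_passes A r (f x @ g y) p) (verdict A r)) True" for r x y
  have M: "finite M" unfolding M_def by (rule finite_bool_lists)
  have space_M: "memory_contents A p (f x @ g y) \<subseteq> M" for x y
    using space by (simp add: M_def)
  have T: "finite T" unfolding T_def by (rule finite_lists_length_eq[OF M])
  have "T \<noteq> {}"
  proof -
    have "replicate (Suc (2 * p)) [] \<in> T" unfolding T_def M_def by auto
    then show ?thesis by auto
  qed
  have fixed_tape: "(\<Sum>i\<in>I. \<Sum>d\<in>Pow (I - {i}). \<Sum>z\<in>Pow (I - {i}).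
      acc r (z \<inter> d) (z - d) - acc r (insert i (z \<inter> d)) (insert i (z - d))) \<le> C"
    if r: "r \<in> set_pmf (tape A)" for r
  proof -
    from factorizes_after_passes[where f = f and g = g, OF r M space_M order_refl]
    obtain a b where ab: "\<forall>t x. 0 \<le> a t x" "\<forall>t y. 0 \<le> b t y"
      and P: "\<forall>x y. \<forall>m\<in>M. pmf (after_passes A r (f x @ g y) p) m
        = (\<Sum>t | set t \<subseteq> M \<and> length t = 2 * p. a (m # t) x * b (m # t) y)"
      unfolding factorizes_def by blast
    have supp: "set_pmf (after_passes A r (f x @ g y) p) \<subseteq> M" for x y
      using after_passes_subset_memory_contents[OF r order_refl] space_M by blast
    have total: "(\<Sum>t\<in>T. a t x * b t y) = 1" for x y
      using sum_pmf_eq_1[OF M supp[of x y]] P unfolding T_def sum_lists_length_Suc by simp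
    have acc: "acc r x y = (\<Sum>t\<in>T. a t x * b t y * pmf (verdict A r (hd t)) True)" for x y
      unfolding acc_def pmf_bind_finite[OF M supp] T_def sum_lists_length_Suc
      using P by (simp add: sum_distrib_right)
    show ?thesis
      unfolding acc C_def using ab total
      by (intro disjointness_transcripts I T) (auto simp: pmf_le_1)
  qed
  have answer: "pmf (answer A p (f x @ g y)) True = (\<integral>r. acc r x y \<partial>tape A)" for x y
    unfolding answer_def pmf_bind[of "tape A"] acc_def ..
  have acc_int: "integrable (measure_pmf (tape A)) (\<lambda>r. acc r x y)" for x y
    by (rule measure_pmf.integrable_const_bound[where B = 1]) (auto simp: acc_def pmf_le_1)
  \<comment> \<open>The gap \<open>2 / 3 - 1 / 3\<close> is guaranteed only on average over the
    tape, while the upper bound \<open>C\<close> holds for every tape; integrating joins the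
    two.\<close>
  have "(\<Sum>i\<in>I. \<Sum>d\<in>Pow (I - {i}). \<Sum>z\<in>Pow (I - {i}). 1 / 3)
    \<le> (\<Sum>i\<in>I. \<Sum>d\<in>Pow (I - {i}). \<Sum>z\<in>Pow (I - {i}). pmf (answer A p (f (z \<inter> d) @ g (z - d))) True
      - pmf (answer A p (f (insert i (z \<inter> d)) @ g (insert i (z - d)))) True)"
  proof (intro sum_mono)
    fix i d z assume idz: "i \<in> I" "d \<in> Pow (I - {i})" "z \<in> Pow (I - {i})"
    have "2 / 3 \<le> pmf (answer A p (f (z \<inter> d) @ g (z - d))) True"
      using idz by (intro disjoint) auto
    moreover have "2 / 3 \<le> pmf (answer A p (f (insert i (z \<inter> d)) @ g (insert i (z - d)))) False"
      using idz by (intro intersect) auto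
    ultimately show "1 / 3 \<le> pmf (answer A p (f (z \<inter> d) @ g (z - d))) True
      - pmf (answer A p (f (insert i (z \<inter> d)) @ g (insert i (z - d)))) True"
      by (simp add: pmf_False_conv_True)
  qed
  also have "\<dots> = (\<integral>r. (\<Sum>i\<in>I. \<Sum>d\<in>Pow (I - {i}). \<Sum>z\<in>Pow (I - {i}).
      acc r (z \<inter> d) (z - d) - acc r (insert i (z \<inter> d)) (insert i (z - d))) \<partial>tape A)"
    unfolding answer
    by (simp add: Bochner_Integration.integral_sum Bochner_Integration.integral_diff acc_int)
  also have "\<dots> \<le> C"
    using fixed_tape by (intro measure_pmf.integral_le_const) (auto simp: AE_measure_pmf_iff acc_int)
  also have "(\<Sum>i\<in>I. \<Sum>d\<in>Pow (I - {i}). \<Sum>z\<in>Pow (I - {i}). 1 / 3 :: real) = (\<Sum>i\<in>I. 4 ^ card I / 12)"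
  proof (intro sum.cong refl)
    fix i assume i: "i \<in> I"
    have "(\<Sum>d\<in>Pow (I - {i}). \<Sum>z\<in>Pow (I - {i}). 1 / 3 :: real)
        = real (card (Pow (I - {i}))) * (real (card (Pow (I - {i}))) / 3)"
      by simp
    also have "\<dots> = 4 ^ card I / 12"
      unfolding card_Pow_remove[OF I i] by (simp add: power_mult_distrib[symmetric])
    finally show "(\<Sum>d\<in>Pow (I - {i}). \<Sum>z\<in>Pow (I - {i}). 1 / 3 :: real) = 4 ^ card I / 12" .
  qed
  finally have "4 ^ card I * (real (card I) / 12) \<le> 4 ^ card I * (12 * ln (card T) + card I / 24)"
    by (simp add: C_def algebra_simps)
  \<comment> \<open>The difference of \<open>1 / 12\<close> and \<open>1 / 24\<close> leaves
    \<open>card I / 24 \<le> 12 * ln (card T)\<close>, whence the factor 288.\<close>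
  then have "real (card I) / 12 \<le> 12 * ln (card T) + card I / 24"
    by simp
  moreover have "ln (card T) \<le> real (s * (2 * p + 1)) * ln 4"
  proof -
    have "card T \<le> (4 ^ s) ^ Suc (2 * p)"
      unfolding T_def card_lists_length_eq[OF M] by (intro power_mono) (auto simp: M_def card_bool_lists_le)
    then have "real (card T) \<le> 4 ^ (s * (2 * p + 1))"
      unfolding power_mult[symmetric] using of_nat_mono by fastforce
    moreover have "0 < real (card T)"
      using T \<open>T \<noteq> {}\<close> by (simp add: card_gt_0_iff)
    ultimately have "ln (card T) \<le> ln (4 ^ (s * (2 * p + 1)))"
      by simp
    then show ?thesis by (simp add: ln_realpow)
  qed
  ultimately show ?thesis by linarith
qed

section \<open>Reduction to vertex connectivity\<close>

text \<open>Both sides have at least \<open>k\<close> vertices, so removing fewer than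
  \<open>k\<close> leaves some \<open>u0\<close> and \<open>v0\<close>, through which all remaining
  vertices are joined.\<close>

lemma vertex_connected_complete_bipartite:
  assumes k: "2 * k \<le> n" and E: "\<And>u v. u < k \<Longrightarrow> k \<le> v \<Longrightarrow> v < n \<Longrightarrow> {u, v} \<in># E"
  shows "vertex_connected k {..<n} E"
proof (cases "k = 0")
  case False
  let ?P = "\<lambda>c. \<exists>S\<subseteq>{..<n}. card S = c \<and> (\<not> connected_graph ({..<n} - S) E \<or> card ({..<n} - S) = 1)"
  \<comment> \<open>Keeping only vertex 0 is an admissible removal, so the minimum in
    \<open>vertex_connectivity\<close> is attained by some set \<open>S\<close>.\<close>
  have "{..<n} - {1..<n} = {0}"
    using False k by auto
  then have "card ({..<n} - {1..<n}) = 1"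
    by simp
  moreover have "{1..<n} \<subseteq> {..<n}"
    by auto
  ultimately have "?P (card {1..<n})"
    by (intro exI[of _ "{1..<n}"] conjI disjI2 refl)
  then have "?P (vertex_connectivity {..<n} E)"
    unfolding vertex_connectivity_def by (rule LeastI)
  then obtain S where S: "S \<subseteq> {..<n}" "card S = vertex_connectivity {..<n} E"
    and sep: "\<not> connected_graph ({..<n} - S) E \<or> card ({..<n} - S) = 1"
    by blast
  have "k \<le> card S"
  proof (rule ccontr)
    assume small: "\<not> k \<le> card S"
    have fin: "finite S" using S(1) finite_subset by blast
    have "\<not> {..<k} \<subseteq> S" "\<not> {k..<n} \<subseteq> S"
      using card_mono[OF fin, of "{..<k}"] card_mono[OF fin, of "{k..<n}"] small k by auto
    then obtain u0 v0 where "u0 \<in> {..<k} - S" "v0 \<in> {k..<n} - S"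
      by blast
    then have u0: "u0 < k" "u0 \<notin> S" and v0: "k \<le> v0" "v0 < n" "v0 \<notin> S"
      by auto
    let ?V = "{..<n} - S"
    let ?R = "{(x, y). x \<in> ?V \<and> y \<in> ?V \<and> {x, y} \<in># E}"
    have V: "u0 \<in> ?V" "v0 \<in> ?V" using u0 v0 k by auto
    have adj: "(u, v) \<in> ?R" "(v, u) \<in> ?R" if "u \<in> ?V" "v \<in> ?V" "u < k" "k \<le> v" for u v
      using that E[of u v] by (auto simp: insert_commute)
    have to_u0: "(w, u0) \<in> ?R\<^sup>*" and from_u0: "(u0, w) \<in> ?R\<^sup>*" if w: "w \<in> ?V" for w
    proof -
      have "(w, u0) \<in> ?R\<^sup>* \<and> (u0, w) \<in> ?R\<^sup>*"
      proof (cases "w < k")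
        case True
        note wv = adj[OF w V(2) True v0(1)] and uv = adj[OF V u0(1) v0(1)]
        show ?thesis
          using converse_rtrancl_into_rtrancl[OF wv(1) r_into_rtrancl[OF uv(2)]]
            converse_rtrancl_into_rtrancl[OF uv(1) r_into_rtrancl[OF wv(2)]] by (rule conjI)
      next
        case False
        then have "k \<le> w" by simp
        from adj[OF V(1) w u0(1) this] show ?thesis
          by (intro conjI r_into_rtrancl)
      qed
      then show "(w, u0) \<in> ?R\<^sup>*" "(u0, w) \<in> ?R\<^sup>*" by auto
    qed
    have "connected_graph ?V E"
      unfolding connected_graph_def by (intro ballI rtrancl_trans[OF to_u0 from_u0])
    moreover have "card {u0, v0} \<le> card ?V"
      using V by (intro card_mono) auto
    ultimately show False
      using sep u0 v0 by auto
  qed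
  then show ?thesis by (simp add: vertex_connected_def S(2))
qed (simp add: vertex_connected_def)

text \<open>Removing the small side except \<open>u0\<close> isolates \<open>v0\<close>, whose only
  possible remaining neighbour is \<open>u0\<close>.\<close>

lemma not_vertex_connected_bipartite:
  assumes "k \<le> n" and u0: "u0 < k" and v0: "k \<le> v0" "v0 < n" and missing: "{u0, v0} \<notin># E"
    and E: "\<And>e. e \<in># E \<Longrightarrow> \<exists>u v. e = {u, v} \<and> u < k \<and> k \<le> v"
  shows "\<not> vertex_connected k {..<n} E"
proof -
  define S where "S = {..<k} - {u0}"
  let ?V = "{..<n} - S"
  let ?R = "{(x, y). x \<in> ?V \<and> y \<in> ?V \<and> {x, y} \<in># E}"
  have isolated: "(v0, y) \<notin> ?R" for y
  proof
    assume y: "(v0, y) \<in> ?R"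
    then obtain u v where "{v0, y} = {u, v}" "u < k" "k \<le> v"
      using E by blast
    then have "y < k" using v0 by (auto simp: doubleton_eq_iff)
    then have "y = u0" using y by (auto simp: S_def)
    then show False using y missing by (auto simp: insert_commute)
  qed
  have "(v0, u0) \<notin> ?R\<^sup>*"
  proof
    assume "(v0, u0) \<in> ?R\<^sup>*"
    then show False
      using isolated u0 v0 by (cases rule: converse_rtranclE) auto
  qed
  moreover have "v0 \<in> ?V" "u0 \<in> ?V"
    using u0 v0 \<open>k \<le> n\<close> by (auto simp: S_def)
  ultimately have "\<not> connected_graph ?V E"
    unfolding connected_graph_def by blast
  moreover have "S \<subseteq> {..<n}" "card S = k - 1"
    using u0 \<open>k \<le> n\<close> by (auto simp: S_def)
  ultimately have "vertex_connectivity {..<n} E \<le> k - 1"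
    unfolding vertex_connectivity_def by (intro Least_le) blast
  \<comment> \<open>From \<open>u0 < k\<close> it follows that \<open>k\<close> is positive, so the
    truncated \<open>k - 1\<close> is indeed below \<open>k\<close>.\<close>
  then show ?thesis
    using u0 by (simp add: vertex_connected_def)
qed

lemma vertex_connectivity_space_lower_bound:
  assumes k: "2 * k \<le> n"
    and dec: "decides_vertex_connected A p n k" and space: "uses_space A p n s"
  shows "real (k * (n - k)) \<le> 288 * (real (s * (2 * p + 1)) * ln 4)"
proof -
  define L where "L = List.product [0..<k] [k..<n]"
  \<comment> \<open>An edge outside both players' sets is streamed twice, which a multigraph
    permits.\<close>
  define h where "h x = map (\<lambda>(u, v). {u, v}) (filter (\<lambda>e. e \<notin> x) L)" for x :: "(nat \<times> nat) set"
  have L: "set L = {..<k} \<times> {k..<n}" unfolding L_def by auto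
  have h: "e \<in> set (h x) \<longleftrightarrow> (\<exists>u v. e = {u, v} \<and> u < k \<and> k \<le> v \<and> v < n \<and> (u, v) \<notin> x)" for e x
    unfolding h_def using L by (auto simp: image_iff)
  have stream: "stream_of n (mset (h x @ h y)) (h x @ h y)" for x y
    unfolding stream_of_def multigraph_def using k by (auto simp: h)
  have "real (card ({..<k} \<times> {k..<n})) \<le> 288 * (real (s * (2 * p + 1)) * ln 4)"
  proof (rule streaming_disjointness_lower_bound[where f = h and g = h and A = A])
    show "memory_contents A p (h x @ h y) \<subseteq> {m. length m \<le> s}" for x y
      using space stream unfolding uses_space_def by blast
  next
    fix x y :: "(nat \<times> nat) set" assume disjoint: "x \<inter> y = {}"
    have "vertex_connected k {..<n} (mset (h x @ h y))"
    proof (rule vertex_connected_complete_bipartite[OF k])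
      fix u v assume uv: "u < k" "k \<le> v" "v < n"
      have "{u, v} \<in> set (h w)" if "(u, v) \<notin> w" for w
        using uv that h by blast
      then show "{u, v} \<in># mset (h x @ h y)"
        using disjoint by auto
    qed
    then show "2 / 3 \<le> pmf (answer A p (h x @ h y)) True"
      using dec stream[of x y] unfolding decides_vertex_connected_def by metis
  next
    fix x y :: "(nat \<times> nat) set" assume xy: "x \<subseteq> {..<k} \<times> {k..<n}" "x \<inter> y \<noteq> {}"
    then obtain u v where "(u, v) \<in> x \<inter> y"
      by auto
    then have uv: "(u, v) \<in> x" "(u, v) \<in> y" "u < k" "k \<le> v" "v < n"
      using xy by auto
    have "\<not> vertex_connected k {..<n} (mset (h x @ h y))"
      using uv k by (intro not_vertex_connected_bipartite[of k n u v]) (auto simp: h doubleton_eq_iff)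
    then show "2 / 3 \<le> pmf (answer A p (h x @ h y)) False"
      using dec stream[of x y] unfolding decides_vertex_connected_def by metis
  qed simp
  then show ?thesis by simp
qed

theorem theorem5p1:
  shows "\<exists>c::real. c > 0 \<and>
    (\<forall>(p::nat) (A :: nat \<Rightarrow> nat \<Rightarrow> stream_alg) (s :: nat \<Rightarrow> nat \<Rightarrow> nat).
       p \<ge> 1 \<longrightarrow>
       (\<forall>n k. 1 \<le> k \<and> real k \<le> real n / 2 \<longrightarrow>
          decides_vertex_connected (A n k) p n k \<and> uses_space (A n k) p n (s n k)) \<longrightarrow>
       (\<forall>n k. 1 \<le> k \<and> real k \<le> real n / 2 \<longrightarrow>
          real (s n k) \<ge> c * (real k * real n / real p)))"
proof (intro exI[of _ "1 / 5184"] conjI allI impI)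
  fix p :: nat and A :: "nat \<Rightarrow> nat \<Rightarrow> stream_alg" and s :: "nat \<Rightarrow> nat \<Rightarrow> nat" and n k :: nat
  assume p: "1 \<le> p" and nk: "1 \<le> k \<and> real k \<le> real n / 2"
    and A: "\<forall>n k. 1 \<le> k \<and> real k \<le> real n / 2 \<longrightarrow>
          decides_vertex_connected (A n k) p n k \<and> uses_space (A n k) p n (s n k)"
  have k: "2 * k \<le> n" using nk by linarith
  \<comment> \<open>With \<open>n - k \<ge> n / 2\<close>, \<open>2 * p + 1 \<le> 3 * p\<close> and
    \<open>ln 4 \<le> 3\<close>, the constant is \<open>2 * 288 * 3 * 3 = 5184\<close>.\<close>
  have "real k * real n / 2 \<le> real k * real (n - k)"
    using nk k by (simp add: of_nat_diff mult_left_mono flip: times_divide_eq_right)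
  also have "\<dots> \<le> 288 * (real (s n k * (2 * p + 1)) * ln 4)"
    using vertex_connectivity_space_lower_bound[OF k] A nk by (metis of_nat_mult)
  also have "\<dots> \<le> 288 * (real (s n k * (3 * p)) * 3)"
    using p ln_le_minus_one[of "4 :: real"]
    by (intro mult_left_mono mult_mono) (auto simp flip: of_nat_mult of_nat_add)
  finally show "1 / 5184 * (real k * real n / real p) \<le> real (s n k)"
    using p by (simp add: field_simps)
qed simp

end
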